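(* For each $n\ge1$ there exists a constant $K_n>0$ depending only on $n$ such that the following holds. Let $f,g\colon\mathbb{R}^n\to\mathbb{R}$ be convex continuous functions with $\mathcal{C}_f=\arg\min f\neq\emptyset$, let $r>0$ and $\mathcal{U}_r:=\{x\in\mathbb{R}^n: d(x,\mathcal{C}_f)\le r\}$. Then for every $x\in\mathcal{U}_r$, $$g(x)-f(x)\;\le\;K_n\,\|s_g-s_f|_{\mathcal{U}_r}\,d(x,\mathcal{C}_f)\;+\;\|g-f|_{\mathcal{C}_f}.$$
   Context: $\partial f(x)=\{v: f(y)-f(x)\ge\langle v,y-x\rangle\ \forall y\}$ is the convex subdifferential and $s_f(x):=\operatorname{dist}(0,\partial f(x))$ is the slope (similarly for $g$). $d(x,\mathcal{C})$ is the Euclidean distance from $x$ to $\mathcal{C}$. For $\omega\colon\mathbb{R}^n\to\mathbb{R}$ and $\mathcal{U}\subset\mathbb{R}^n$, $\|\omega|_{\mathcal{U}}:=\sup_{x\in\mathcal{U}}\max\{\omega(x),0\}$. *)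

theory Defs
  imports "HOL-Analysis.Analysis"
begin

definition subdiff :: "('a::real_inner \<Rightarrow> real) \<Rightarrow> 'a \<Rightarrow> 'a set" where
  "subdiff f x = {v. \<forall>y. f y - f x \<ge> inner v (y - x)}"

definition slope :: "('a::real_inner \<Rightarrow> real) \<Rightarrow> 'a \<Rightarrow> real" where
  "slope f x = infdist 0 (subdiff f x)"

definition argmin_set :: "('a \<Rightarrow> real) \<Rightarrow> 'a set" where
  "argmin_set f = {x. \<forall>y. f x \<le> f y}"

definition pos_sup :: "('a \<Rightarrow> real) \<Rightarrow> 'a set \<Rightarrow> ereal" where
  "pos_sup w U = (SUP x\<in>U. ereal (max (w x) 0))"

end

theory Submission
  imports Defs
begin

text \<open>
  Run the proximal point algorithm for \<open>f\<close> with step size \<open>\<mu>\<close> from \<open>x\<close>. Along it \<open>f\<close> drops at each step by at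
  least the step length times the slope of \<open>f\<close> at the new point, while \<open>g\<close> drops by at most the step
  length times the slope of \<open>g\<close> at the old point. Summing, \<open>g - f\<close> drops in total by at most the supremum
  of \<open>s\<^sub>g - s\<^sub>f\<close> times the length of the sequence, up to an error \<open>O(\<mu>)\<close>, and the sequence accumulates at
  a minimiser of \<open>f\<close>. The sequence is self-contracted, and self-contracted sequences in a Euclidean
  space have length at most a dimensional constant times their diameter, which here is at most
  \<open>2 d(x, C\<^sub>f)\<close>. Finally let \<open>\<mu> \<rightarrow> 0\<close>.
\<close>

section \<open>Length of self-contracted sequences\<close>

text \<open>Normalise \<open>A\<close> to unit vectors \<open>B\<close>. From each ball of a 1/2-net
  of the sphere that meets \<open>B\<close>, pick one vector of \<open>B\<close>, and let
  \<open>w\<close> be the sum. Against \<open>u\<close> in \<open>B\<close>, the pick near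
  \<open>u\<close> contributes at least 1/2 and acuteness makes the others nonnegative. The norm of
  \<open>w\<close> is at most \<open>card E\<close>, so rounding it to a fixed 1/4-net of that ball
  costs only 1/4.\<close>

lemma acute_direction_net:
  "\<exists>X::'a::euclidean_space set. finite X \<and>
     (\<forall>A. (\<forall>u\<in>A. \<forall>v\<in>A. 0 \<le> inner u v) \<longrightarrow> (\<exists>\<xi>\<in>X. \<forall>u\<in>A. norm u / 4 \<le> inner \<xi> u))"
proof -
  obtain E :: "'a set" where E: "finite E" "sphere 0 1 \<subseteq> (\<Union>e\<in>E. ball e (1/2))"
    using compact_sphere[of "0::'a" 1] unfolding compact_eq_totally_bounded
    by (elim conjE allE[of _ "1/2"]) auto
  obtain X :: "'a set" where X: "finite X" "cball 0 (real (card E)) \<subseteq> (\<Union>e\<in>X. ball e (1/4))"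
    using compact_cball[of "0::'a" "real (card E)"] unfolding compact_eq_totally_bounded
    by (elim conjE allE[of _ "1/4"]) auto
  have "\<exists>\<xi>\<in>X. \<forall>u\<in>A. norm u / 4 \<le> inner \<xi> u" if A: "\<forall>u\<in>A. \<forall>v\<in>A. 0 \<le> inner u v" for A
  proof -
    define B where "B = sgn ` (A - {0})"
    have B1: "norm u = 1" if "u \<in> B" for u
      using that by (auto simp: B_def norm_sgn split: if_splits)
    have B2: "0 \<le> inner u v" if "u \<in> B" "v \<in> B" for u v
      using that A by (auto simp: B_def sgn_div_norm)
    define E' where "E' = {e\<in>E. B \<inter> ball e (1/2) \<noteq> {}}"
    have finE': "finite E'" using E by (simp add: E'_def)
    have "\<forall>e\<in>E'. \<exists>u. u \<in> B \<and> u \<in> ball e (1/2)" unfolding E'_def by blast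
    then obtain a where a: "\<And>e. e \<in> E' \<Longrightarrow> a e \<in> B \<and> a e \<in> ball e (1/2)"
      unfolding bchoice_iff by blast
    define w where "w = (\<Sum>e\<in>E'. a e)"
    have "norm w \<le> (\<Sum>e\<in>E'. 1)"
      unfolding w_def by (rule sum_norm_le) (use a B1 in force)
    also have "\<dots> \<le> real (card E)"
      using E by (simp add: E'_def card_mono)
    finally have "w \<in> cball 0 (real (card E))" by simp
    then obtain \<xi> where \<xi>: "\<xi> \<in> X" "dist \<xi> w < 1/4" using X by auto
    have wu: "1/2 \<le> inner w u" if u: "u \<in> B" for u
    proof -
      obtain e where e: "e \<in> E" "u \<in> ball e (1/2)" using E B1[OF u] by (auto simp: subset_iff)
      with u have eE': "e \<in> E'" by (auto simp: E'_def)
      \<comment> \<open>Unit vectors at distance below 1 have inner product above 1/2.\<close>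
      have "dist u (a e) < 1"
        using a[OF eE'] e(2) dist_triangle[of u "a e" e] by (simp add: dist_commute)
      then have "(norm (u - a e))\<^sup>2 < 1" by (simp add: dist_norm abs_square_less_1)
      moreover have "(norm (u - a e))\<^sup>2 = (norm u)\<^sup>2 + (norm (a e))\<^sup>2 - 2 * inner (a e) u"
        by (simp add: power2_norm_eq_inner inner_diff_left inner_diff_right inner_commute)
      ultimately have "1/2 \<le> inner (a e) u" using B1[OF u] B1[of "a e"] a[OF eE'] by simp
      also have "\<dots> \<le> (\<Sum>e\<in>E'. inner (a e) u)"
        by (rule member_le_sum[OF eE']) (use a u B2 finE' in auto)
      finally show ?thesis by (simp add: w_def inner_sum_left)
    qed
    have "norm u / 4 \<le> inner \<xi> u" if u: "u \<in> A" for u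
    proof (cases "u = 0")
      case False
      then have uB: "sgn u \<in> B" using u by (auto simp: B_def)
      have "\<bar>inner (\<xi> - w) (sgn u)\<bar> \<le> norm (\<xi> - w) * norm (sgn u)"
        by (rule Cauchy_Schwarz_ineq2)
      then have "1/4 \<le> inner \<xi> (sgn u)"
        using wu[OF uB] \<xi>(2) B1[OF uB] by (auto simp: dist_norm inner_diff_left)
      then show ?thesis using False by (simp add: sgn_div_norm field_simps)
    qed simp
    then show ?thesis using \<xi> by blast
  qed
  then show ?thesis using X(1) by blast
qed

text \<open>For each direction \<open>\<xi>\<close> the minimum of \<open>\<xi>\<close> over the tail \<open>x j, \<dots>, x N\<close> is nondecreasing in \<open>j\<close>.
  Self-contractedness makes the vectors \<open>x k - x j\<close> pairwise acute, so for one \<open>\<xi>\<close> of a fixed finite net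
  this minimum grows at step \<open>j\<close> by a definite fraction of the step length.\<close>

lemma self_contracted_length:
  "\<exists>K>0. \<forall>(x::nat \<Rightarrow> 'a::euclidean_space) D N.
     (\<forall>i j k. i \<le> j \<longrightarrow> j \<le> k \<longrightarrow> dist (x j) (x k) \<le> dist (x i) (x k)) \<and>
     (\<forall>j k. dist (x j) (x k) \<le> D) \<longrightarrow>
     (\<Sum>j<N. dist (x j) (x (Suc j))) \<le> K * D"
proof -
  obtain X :: "'a set" where X: "finite X" and net:
    "\<And>A. (\<forall>u\<in>A. \<forall>v\<in>A. 0 \<le> inner u v) \<Longrightarrow> \<exists>\<xi>\<in>X. \<forall>u\<in>A. norm u / 4 \<le> inner \<xi> u"
    using acute_direction_net by blast
  \<comment> \<open>The 8 is the 4 of the net times the 2 lost in comparing a step with the distance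
    to a later point. The 1 secures \<open>K > 0\<close> without inspecting
    \<open>X\<close>.\<close>
  define K where "K = 8 * (\<Sum>\<xi>\<in>X. norm \<xi>) + 1"
  have "(\<Sum>j<N. dist (x j) (x (Suc j))) \<le> K * D"
    if sc: "\<And>i j k. i \<le> j \<Longrightarrow> j \<le> k \<Longrightarrow> dist (x j) (x k) \<le> dist (x i) (x k)"
      and D: "\<And>j k. dist (x j) (x k) \<le> D" for x :: "nat \<Rightarrow> 'a" and D N
  proof -
    have D0: "0 \<le> D" using D[of 0 0] by simp
    define h where "h j \<xi> = Min ((\<lambda>k. inner \<xi> (x k)) ` {j..N})" for j \<xi>
    have h_mono: "h j \<xi> \<le> h (Suc j) \<xi>" if "j < N" for j \<xi>
      unfolding h_def using that by (intro Min_antimono image_mono) auto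
    have step: "dist (x j) (x (Suc j)) / 8 \<le> (\<Sum>\<xi>\<in>X. h (Suc j) \<xi> - h j \<xi>)" if j: "j < N" for j
    proof -
      let ?A = "(\<lambda>k. x k - x j) ` {Suc j..N}"
      \<comment> \<open>Expand \<open>x k - x l\<close> as the difference of the two vectors:
        contraction bounds twice their inner product below by the squared norm of
        \<open>x k - x j\<close>.\<close>
      have acute: "0 \<le> inner (x k - x j) (x l - x j)" if "j \<le> k" "k \<le> l" for k l
      proof -
        have "(dist (x k) (x l))\<^sup>2 \<le> (dist (x j) (x l))\<^sup>2"
          using sc[OF that] by simp
        moreover have "(dist (x k) (x l))\<^sup>2 =
            (norm (x k - x j))\<^sup>2 + (dist (x j) (x l))\<^sup>2 - 2 * inner (x k - x j) (x l - x j)"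
          by (simp add: dist_norm power2_norm_eq_inner inner_diff_left inner_diff_right inner_commute)
        ultimately show ?thesis using zero_le_power2[of "norm (x k - x j)"] by linarith
      qed
      have "\<forall>u\<in>?A. \<forall>v\<in>?A. 0 \<le> inner u v"
      proof (clarify)
        fix k l assume "k \<in> {Suc j..N}" "l \<in> {Suc j..N}"
        then show "0 \<le> inner (x k - x j) (x l - x j)"
          using acute[of k l] acute[of l k] by (cases "k \<le> l") (auto simp: inner_commute)
      qed
      then obtain \<xi> where \<xi>: "\<xi> \<in> X" "\<And>k. k \<in> {Suc j..N} \<Longrightarrow> norm (x k - x j) / 4 \<le> inner \<xi> (x k - x j)"
        using net by (metis (no_types, lifting) imageI)
      have "h j \<xi> + dist (x j) (x (Suc j)) / 8 \<le> inner \<xi> (x k)" if k: "k \<in> {Suc j..N}" for k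
      proof -
        have "h j \<xi> \<le> inner \<xi> (x j)" unfolding h_def using j by (intro Min_le) auto
        \<comment> \<open>\<open>x (Suc j)\<close> is no farther from \<open>x k\<close> than
          \<open>x j\<close> is, so the triangle inequality costs only a factor 2.\<close>
        moreover have "dist (x j) (x (Suc j)) \<le> 2 * dist (x j) (x k)"
          using sc[of j "Suc j" k] k dist_triangle[of "x j" "x (Suc j)" "x k"] by (simp add: dist_commute)
        ultimately show ?thesis using \<xi>(2)[OF k]
          by (simp add: dist_norm norm_minus_commute inner_diff_right)
      qed
      then have "h j \<xi> + dist (x j) (x (Suc j)) / 8 \<le> h (Suc j) \<xi>"
        unfolding h_def[of "Suc j"] using j by (intro Min.boundedI) auto
      then have "dist (x j) (x (Suc j)) / 8 \<le> h (Suc j) \<xi> - h j \<xi>" by simp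
      \<comment> \<open>The good direction depends on \<open>j\<close>; adding the nonnegative
        increments of all others gives a bound that can be summed over \<open>j\<close>.\<close>
      also have "\<dots> \<le> (\<Sum>\<xi>\<in>X. h (Suc j) \<xi> - h j \<xi>)"
        by (rule member_le_sum[OF \<xi>(1)]) (use h_mono[OF j] X in auto)
      finally show ?thesis .
    qed
    have total: "h N \<xi> - h 0 \<xi> \<le> norm \<xi> * D" for \<xi>
    proof -
      have "h 0 \<xi> \<in> (\<lambda>k. inner \<xi> (x k)) ` {0..N}" unfolding h_def by (intro Min_in) auto
      then obtain k where k: "h 0 \<xi> = inner \<xi> (x k)" by auto
      have "h N \<xi> - h 0 \<xi> = inner \<xi> (x N - x k)"
        unfolding k by (simp add: h_def inner_diff_right)
      also have "\<dots> \<le> norm \<xi> * norm (x N - x k)" by (rule norm_cauchy_schwarz)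
      also have "\<dots> \<le> norm \<xi> * D" using D[of N k] by (intro mult_left_mono) (auto simp: dist_norm)
      finally show ?thesis .
    qed
    have "(\<Sum>j<N. dist (x j) (x (Suc j))) / 8 \<le> (\<Sum>j<N. \<Sum>\<xi>\<in>X. h (Suc j) \<xi> - h j \<xi>)"
      unfolding sum_divide_distrib by (intro sum_mono step) auto
    also have "\<dots> = (\<Sum>\<xi>\<in>X. h N \<xi> - h 0 \<xi>)"
      by (subst sum.swap) (simp only: sum_lessThan_telescope[of "\<lambda>j. h j \<xi>" for \<xi>])
    also have "\<dots> \<le> (\<Sum>\<xi>\<in>X. norm \<xi> * D)" by (intro sum_mono total)
    also have "\<dots> = (\<Sum>\<xi>\<in>X. norm \<xi>) * D" by (rule sum_distrib_right[symmetric])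
    finally show ?thesis using D0 by (simp add: K_def algebra_simps)
  qed
  moreover have "0 \<le> (\<Sum>\<xi>\<in>X. norm \<xi>)" by (intro sum_nonneg norm_ge_zero)
  then have "K > 0" by (simp add: K_def)
  ultimately show ?thesis by blast
qed

section \<open>Subgradients and slopes of convex functions\<close>

text \<open>Separate \<open>(x, f x)\<close> from the strict epigraph; a non-vertical separating
  hyperplane, rescaled, is a subgradient.\<close>

lemma subdiff_nonempty:
  fixes f :: "'a::euclidean_space \<Rightarrow> real"
  assumes "convex_on UNIV f"
  shows "subdiff f x \<noteq> {}"
proof -
  let ?S = "{z::'a \<times> real. f (fst z) < snd z}"
  have "convex ?S"
  proof (rule convexI)
    fix y z :: "'a \<times> real" and u v :: real
    assume *: "y \<in> ?S" "z \<in> ?S" "0 \<le> u" "0 \<le> v" "u + v = 1"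
    have "f (u *\<^sub>R fst y + v *\<^sub>R fst z) \<le> u * f (fst y) + v * f (fst z)"
      using assms * by (auto simp: convex_on_def)
    also have "\<dots> < u * snd y + v * snd z"
    proof (cases "u = 0")
      case True then show ?thesis using * by simp
    next
      case False
      then have "u * f (fst y) < u * snd y" using * by simp
      moreover have "v * f (fst z) \<le> v * snd z" using * by (intro mult_left_mono) auto
      ultimately show ?thesis by simp
    qed
    finally show "u *\<^sub>R y + v *\<^sub>R z \<in> ?S" by simp
  qed
  moreover have "?S \<noteq> {}" by (auto intro!: exI[of _ x] exI[of _ "f x + 1"])
  ultimately obtain a b where ab: "a \<noteq> 0" "inner a (x, f x) \<le> b" "\<And>z. z \<in> ?S \<Longrightarrow> b \<le> inner a z"
    using separating_hyperplane_sets[of "{(x, f x)}" ?S] by auto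
  obtain p \<alpha> where a: "a = (p, \<alpha>)" by (cases a)
  have sep: "0 \<le> inner p (y - x) + \<alpha> * (t - f x)" if "f y < t" for y t
    using ab(2) ab(3)[of "(y, t)"] that by (simp add: a inner_diff_right algebra_simps)
  have "0 \<le> \<alpha>" using sep[of x "f x + 1"] by simp
  \<comment> \<open>A vertical hyperplane would leave the whole space on one side of it; the point
    \<open>x - p\<close> refutes this.\<close>
  moreover have "\<alpha> \<noteq> 0"
  proof
    assume "\<alpha> = 0"
    then have "0 \<le> inner p (- p)" using sep[of "x - p" "f (x - p) + 1"] by simp
    then have "inner p p \<le> 0" by simp
    then have "p = 0" by (metis antisym inner_eq_zero_iff inner_ge_zero)
    then show False using ab(1) a \<open>\<alpha> = 0\<close> by (simp add: zero_prod_def)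
  qed
  ultimately have \<alpha>: "\<alpha> > 0" by simp
  have "inner (- (1 / \<alpha>) *\<^sub>R p) (y - x) \<le> f y - f x" for y
  \<comment> \<open>\<open>sep\<close> holds only strictly above the graph, so the height
    \<open>t\<close> is let down to \<open>f y\<close>.\<close>
  proof (rule field_le_epsilon)
    fix e :: real assume "e > 0"
    then show "inner (- (1 / \<alpha>) *\<^sub>R p) (y - x) \<le> f y - f x + e"
      using sep[of y "f y + e"] \<alpha> by (simp add: field_simps)
  qed
  then show ?thesis unfolding subdiff_def by blast
qed

text \<open>Apply Cauchy-Schwarz to each subgradient at \<open>x\<close> and take the infimum of the
  norms. Nonemptiness matters: \<open>infdist\<close> to the empty set is 0 by convention.\<close>

lemma slope_lower_bound:
  fixes g :: "'a::euclidean_space \<Rightarrow> real"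
  assumes "convex_on UNIV g"
  shows "g x - g y \<le> slope g x * dist x y"
proof (cases "x = y")
  case False
  have "(g x - g y) / dist x y \<le> dist 0 v" if "v \<in> subdiff g x" for v
  proof -
    have "g x - g y \<le> inner v (x - y)" using that by (simp add: subdiff_def inner_diff_right algebra_simps)
    also have "\<dots> \<le> norm v * dist x y" by (simp add: dist_norm norm_cauchy_schwarz)
    finally show ?thesis using False by (simp add: field_simps)
  qed
  then have "(g x - g y) / dist x y \<le> slope g x"
    unfolding slope_def infdist_notempty[OF subdiff_nonempty[OF assms]]
    by (intro cINF_greatest subdiff_nonempty assms)
  then show ?thesis using False by (simp add: field_simps)
qed simp

lemma slope_le: "v \<in> subdiff f x \<Longrightarrow> slope f x \<le> norm v"
  unfolding slope_def using infdist_le[of v "subdiff f x" 0] by simp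

section \<open>The proximal step\<close>

text \<open>A minimiser \<open>y\<close> of \<open>F\<close>, that is of \<open>f\<close> plus a
  quadratic penalty, works: compare \<open>F y\<close> with \<open>F\<close> on the segment towards
  \<open>z\<close>, divide by \<open>t\<close> and let \<open>t\<close> tend to 0.\<close>

lemma proximal_point_exists:
  fixes f :: "'a::euclidean_space \<Rightarrow> real"
  assumes cvx: "convex_on UNIV f" and cont: "continuous_on UNIV f"
    and bdd: "\<And>y. m \<le> f y" and lam: "\<mu> > 0"
  shows "\<exists>y. (1 / \<mu>) *\<^sub>R (x - y) \<in> subdiff f y"
proof -
  define F where "F y = f y + (dist x y)\<^sup>2 / (2 * \<mu>)" for y
  \<comment> \<open>Outside this ball the penalty alone is at least \<open>f x - m\<close>, so a
    minimum over the ball is global.\<close>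
  define R where "R = sqrt (2 * \<mu> * (f x - m))"
  have R0: "R \<ge> 0" "R\<^sup>2 = 2 * \<mu> * (f x - m)" using bdd[of x] lam by (auto simp: R_def)
  have "continuous_on (cball x R) F"
    unfolding F_def using cont by (intro continuous_intros) (use lam in \<open>auto elim: continuous_on_subset\<close>)
  then obtain y where y: "y \<in> cball x R" "\<And>z. z \<in> cball x R \<Longrightarrow> F y \<le> F z"
    using continuous_attains_inf[of "cball x R" F] R0 by auto
  have min: "F y \<le> F z" for z
  proof (cases "z \<in> cball x R")
    case False
    then have "R\<^sup>2 \<le> (dist x z)\<^sup>2" using R0 by (intro power_mono) auto
    then have "f x - m \<le> (dist x z)\<^sup>2 / (2 * \<mu>)" using lam R0 by (simp add: field_simps)
    then have "F x \<le> F z" using bdd[of z] by (simp add: F_def)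
    moreover have "F y \<le> F x" using y R0 by auto
    ultimately show ?thesis by simp
  qed (use y in auto)
  have "inner ((1 / \<mu>) *\<^sub>R (x - y)) (z - y) \<le> f z - f y" for z
  proof -
    define c where "c = (dist z y)\<^sup>2 / (2 * \<mu>)"
    have ineq: "inner ((1 / \<mu>) *\<^sub>R (x - y)) (z - y) \<le> f z - f y + t * c" if t: "0 < t" "t \<le> 1" for t
    proof -
      let ?w = "(1 - t) *\<^sub>R y + t *\<^sub>R z"
      have "f ?w \<le> (1 - t) * f y + t * f z"
        using cvx t by (auto simp: convex_on_def)
      moreover have "(dist x ?w)\<^sup>2 = (dist x y)\<^sup>2 - 2 * t * inner (x - y) (z - y) + t\<^sup>2 * (dist z y)\<^sup>2"
      proof -
        have "x - ?w = (x - y) - t *\<^sub>R (z - y)" by (simp add: algebra_simps)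
        then show ?thesis
          unfolding dist_norm power2_norm_eq_inner
          by (simp add: inner_diff_left inner_diff_right inner_commute power2_eq_square algebra_simps)
      qed
      moreover have "(dist x ?w)\<^sup>2 / (2 * \<mu>) = (dist x y)\<^sup>2 / (2 * \<mu>)
          + (t\<^sup>2 * (dist z y)\<^sup>2 - 2 * t * inner (x - y) (z - y)) / (2 * \<mu>)"
        unfolding calculation(2) by (simp add: add_divide_distrib diff_divide_distrib)
      ultimately have "0 \<le> t * (f z - f y) + (t\<^sup>2 * (dist z y)\<^sup>2 - 2 * t * inner (x - y) (z - y)) / (2 * \<mu>)"
        using min[of ?w] unfolding F_def left_diff_distrib right_diff_distrib mult_1 by linarith
      also have "\<dots> = t * (f z - f y + t * c - inner ((1 / \<mu>) *\<^sub>R (x - y)) (z - y))"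
        unfolding inner_scaleR_left using lam by (simp add: c_def field_simps power2_eq_square)
      finally show ?thesis using t by (simp add: zero_le_mult_iff)
    qed
    have "((\<lambda>t. f z - f y + t * c) \<longlongrightarrow> f z - f y + 0 * c) (at_right 0)"
      by (intro tendsto_intros)
    moreover have "\<forall>\<^sub>F t in at_right 0. inner ((1 / \<mu>) *\<^sub>R (x - y)) (z - y) \<le> f z - f y + t * c"
      unfolding eventually_at_right_field using ineq by (intro exI[of _ 1]) auto
    ultimately show ?thesis
      using tendsto_lowerbound[of "\<lambda>t. f z - f y + t * c" "f z - f y + 0 * c" "at_right (0::real)"] by simp
  qed
  then show ?thesis unfolding subdiff_def by blast
qed

text \<open>Test the subgradient inequality at \<open>y\<close>: the point \<open>x\<close> gives
  descent, and a point \<open>z\<close> with \<open>f z \<le> f y\<close> gives an obtuse angle at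
  \<open>y\<close>, hence contraction. Descent against any subgradient at \<open>x\<close> bounds
  the step by the old slope. The last two facts together make slopes decrease along the
  iteration.\<close>

lemma proximal_step:
  fixes f :: "'a::euclidean_space \<Rightarrow> real"
  assumes cvx: "convex_on UNIV f" and lam: "\<mu> > 0"
    and sub: "(1 / \<mu>) *\<^sub>R (x - y) \<in> subdiff f y"
  shows proximal_step_descent: "(dist x y / \<mu>) * dist x y \<le> f x - f y"
    and proximal_step_contracts: "f z \<le> f y \<Longrightarrow> dist y z \<le> dist x z"
    and proximal_step_le_slope: "dist x y / \<mu> \<le> slope f x"
    and slope_le_proximal_step: "slope f y \<le> dist x y / \<mu>"
proof -
  have S: "inner (x - y) (z - y) / \<mu> \<le> f z - f y" for z
    using sub by (simp add: subdiff_def)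
  show "(dist x y / \<mu>) * dist x y \<le> f x - f y"
    using S[of x] by (simp add: dist_norm dot_square_norm power2_eq_square)
  show "dist y z \<le> dist x z" if "f z \<le> f y" for z
  proof -
    have "inner (x - y) (z - y) \<le> 0"
      using order_trans[OF S[of z], of 0] that lam by (simp add: divide_le_0_iff)
    moreover have "(dist x z)\<^sup>2 = (dist y z)\<^sup>2 + (norm (x - y))\<^sup>2 - 2 * inner (x - y) (z - y)"
      by (simp add: dist_norm power2_norm_eq_inner inner_diff_left inner_diff_right inner_commute)
    ultimately have "(dist y z)\<^sup>2 \<le> (dist x z)\<^sup>2"
      using zero_le_power2[of "norm (x - y)"] by linarith
    then show ?thesis by (rule power2_le_imp_le) simp
  qed
  show "slope f y \<le> dist x y / \<mu>"
    using slope_le[OF sub] lam by (simp add: dist_norm)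
  have "dist x y / \<mu> \<le> dist 0 w" if w: "w \<in> subdiff f x" for w
  proof (cases "x = y")
    case False
    have "(dist x y / \<mu>) * dist x y \<le> f x - f y" by fact
    also have "\<dots> \<le> inner w (x - y)"
    proof -
      have "inner w (y - x) \<le> f y - f x" using w by (simp add: subdiff_def)
      then show ?thesis by (simp add: inner_diff_right)
    qed
    also have "\<dots> \<le> norm w * dist x y" by (simp add: dist_norm norm_cauchy_schwarz)
    finally show ?thesis using False by (simp only: mult_le_cancel_right) simp
  qed simp
  then show "dist x y / \<mu> \<le> slope f x"
    unfolding slope_def infdist_notempty[OF subdiff_nonempty[OF cvx]]
    by (intro cINF_greatest subdiff_nonempty cvx)
qed

section \<open>Comparison along the proximal sequence\<close>

lemma closed_argmin_set:
  fixes f :: "'a::topological_space \<Rightarrow> real"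
  assumes "continuous_on UNIV f"
  shows "closed (argmin_set f)"
proof -
  have "argmin_set f = (\<Inter>y. {x. f x \<le> f y})" by (auto simp: argmin_set_def)
  also have "closed \<dots>" by (intro closed_INT ballI closed_Collect_le assms continuous_intros)
  finally show ?thesis .
qed

text \<open>The real-valued core of the theorem, with \<open>\<epsilon>\<close> and \<open>M\<close>
  standing for finite suprema. Slopes are compared only up to the distance of \<open>x0\<close>,
  since the iterates never move farther from the minimisers than that.\<close>

lemma slope_comparison:
  "\<exists>K>0. \<forall>(f::'a::euclidean_space \<Rightarrow> real) (g::'a \<Rightarrow> real) x0 \<epsilon> M.
    convex_on UNIV f \<and> convex_on UNIV g \<and> continuous_on UNIV f \<and> continuous_on UNIV g
    \<and> argmin_set f \<noteq> {} \<and> 0 \<le> \<epsilon>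
    \<and> (\<forall>y. infdist y (argmin_set f) \<le> infdist x0 (argmin_set f) \<longrightarrow> slope g y \<le> slope f y + \<epsilon>)
    \<and> (\<forall>y\<in>argmin_set f. g y - f y \<le> M) \<longrightarrow>
    g x0 - f x0 \<le> K * \<epsilon> * infdist x0 (argmin_set f) + M"
proof -
  obtain K where K0: "K > 0" and K: "\<forall>(x::nat \<Rightarrow> 'a) D N.
     (\<forall>i j k. i \<le> j \<longrightarrow> j \<le> k \<longrightarrow> dist (x j) (x k) \<le> dist (x i) (x k)) \<and>
     (\<forall>j k. dist (x j) (x k) \<le> D) \<longrightarrow>
     (\<Sum>j<N. dist (x j) (x (Suc j))) \<le> K * D"
    using self_contracted_length[where 'a='a] by (elim exE conjE)
  have "g x0 - f x0 \<le> 2 * K * \<epsilon> * infdist x0 (argmin_set f) + M"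
    if f: "convex_on UNIV f" "continuous_on UNIV f" and g: "convex_on UNIV g" "continuous_on UNIV g"
      and ne: "argmin_set f \<noteq> {}" and \<epsilon>: "0 \<le> \<epsilon>"
      and sl: "\<And>y. infdist y (argmin_set f) \<le> infdist x0 (argmin_set f) \<Longrightarrow> slope g y \<le> slope f y + \<epsilon>"
      and M: "\<And>y. y \<in> argmin_set f \<Longrightarrow> g y - f y \<le> M"
    for f g :: "'a \<Rightarrow> real" and x0 \<epsilon> M
  proof -
    define d where "d = infdist x0 (argmin_set f)"
    obtain p where p: "p \<in> argmin_set f" "d = dist x0 p"
      using infdist_attains_inf[OF closed_argmin_set[OF f(2)] ne] unfolding d_def by metis
    have pmin: "f p \<le> f y" for y using p by (auto simp: argmin_set_def)
    \<comment> \<open>The last term is the cost of discretisation; nothing else on the right depends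
      on \<open>\<mu>\<close>.\<close>
    have bound: "g x0 - f x0 \<le> 2 * K * \<epsilon> * d + M + \<mu> * (slope f x0)\<^sup>2" if lam: "\<mu> > 0" for \<mu>
    proof -
      obtain P where P: "\<And>x. (1 / \<mu>) *\<^sub>R (x - P x) \<in> subdiff f (P x)"
        using proximal_point_exists[OF f pmin lam] by metis
      define x where "x k = (P ^^ k) x0" for k
      have x0: "x 0 = x0" by (simp add: x_def)
      have sub: "(1 / \<mu>) *\<^sub>R (x k - x (Suc k)) \<in> subdiff f (x (Suc k))" for k
        by (simp add: x_def P)
      note descent = proximal_step_descent[OF f(1) lam sub]
        and contracts = proximal_step_contracts[OF f(1) lam sub]
        and le_slope = proximal_step_le_slope[OF f(1) lam sub]
        and slope_le = slope_le_proximal_step[OF f(1) lam sub]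
      have "f (x (Suc k)) \<le> f (x k)" for k
        using descent[of k] lam by (smt (verit) divide_nonneg_pos mult_nonneg_nonneg zero_le_dist)
      then have f_mono: "f (x k) \<le> f (x j)" if "j \<le> k" for j k
        using lift_Suc_antimono_le[of "\<lambda>k. f (x k)"] that by blast
      \<comment> \<open>Later iterates have lower values, so every step before \<open>k\<close>
        moves no farther from \<open>x k\<close>.\<close>
      have sc: "dist (x j) (x k) \<le> dist (x i) (x k)" if "i \<le> j" "j \<le> k" for i j k
        using that
      proof (induction j rule: dec_induct)
        case (step j)
        then show ?case using contracts[of "x k" j] f_mono[of "Suc j" k] by auto
      qed simp
      \<comment> \<open>The same contraction towards \<open>p\<close> keeps the sequence in a ball
        of radius \<open>d\<close>, hence of diameter \<open>2 * d\<close>.\<close>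
      have fejer: "dist (x k) p \<le> d" for k
      proof (induction k)
        case (Suc k)
        then show ?case using contracts[OF pmin, of k] by linarith
      qed (simp add: x0 p)
      have len: "(\<Sum>j<N. dist (x j) (x (Suc j))) \<le> K * (2 * d)" for N
      proof -
        have "dist (x j) (x k) \<le> 2 * d" for j k
          using fejer[of j] fejer[of k] dist_triangle2[of "x j" "x k" p] by linarith
        then show ?thesis using K sc by blast
      qed
      have d0: "0 \<le> d" by (simp add: p)
      have s_mono: "slope f (x (Suc k)) \<le> slope f (x k)" for k
        using slope_le[of k] le_slope[of k] by linarith
      have s_le: "slope f (x k) \<le> slope f x0" for k
        using lift_Suc_antimono_le[of "\<lambda>k. slope f (x k)" 0 k] s_mono x0 by simp
      have s_nonneg: "0 \<le> slope f y" for y by (simp add: slope_def infdist_nonneg)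
      define s where "s k = slope f (x k)" for k
      define \<phi> where "\<phi> k = g (x k) - f (x k)" for k
      \<comment> \<open>Descent of \<open>f\<close> sees the slope at the new point, the bound for
        \<open>g\<close> the slope at the old one. The mismatch is a decrement of \<open>s\<close>
        times a step of length at most \<open>\<mu> * slope f x0\<close>, so it telescopes.\<close>
      have step: "\<phi> k - \<phi> (Suc k) \<le> \<epsilon> * dist (x k) (x (Suc k)) + (\<mu> * slope f x0) * (s k - s (Suc k))" for k
      proof -
        let ?\<delta> = "dist (x k) (x (Suc k))"
        have "infdist (x k) (argmin_set f) \<le> d"
          using infdist_le[OF p(1), of "x k"] fejer[of k] by linarith
        then have "slope g (x k) \<le> s k + \<epsilon>" using sl by (simp add: d_def s_def)
        then have "slope g (x k) * ?\<delta> \<le> (s k + \<epsilon>) * ?\<delta>" by (rule mult_right_mono) simp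
        then have "g (x k) - g (x (Suc k)) \<le> (s k + \<epsilon>) * ?\<delta>"
          using slope_lower_bound[OF g(1), of "x k" "x (Suc k)"] by linarith
        moreover have "s (Suc k) * ?\<delta> \<le> (?\<delta> / \<mu>) * ?\<delta>"
          unfolding s_def by (intro mult_right_mono slope_le) simp
        ultimately have "\<phi> k - \<phi> (Suc k) \<le> \<epsilon> * ?\<delta> + (s k - s (Suc k)) * ?\<delta>"
          using descent[of k] by (simp add: \<phi>_def algebra_simps)
        moreover have "?\<delta> / \<mu> \<le> slope f x0" using le_slope[of k] s_le[of k] by linarith
        then have "?\<delta> \<le> \<mu> * slope f x0" using lam by (simp add: field_simps)
        then have "(s k - s (Suc k)) * ?\<delta> \<le> (s k - s (Suc k)) * (\<mu> * slope f x0)"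
          using s_mono[of k] by (intro mult_left_mono) (auto simp: s_def)
        ultimately show ?thesis by (simp add: mult.commute)
      qed
      have \<phi>_bound: "g x0 - f x0 \<le> 2 * K * \<epsilon> * d + \<mu> * (slope f x0)\<^sup>2 + \<phi> N" for N
      proof -
        have "\<phi> 0 - \<phi> N = (\<Sum>k<N. \<phi> k - \<phi> (Suc k))" by (simp add: sum_lessThan_telescope')
        also have "\<dots> \<le> (\<Sum>k<N. \<epsilon> * dist (x k) (x (Suc k)) + (\<mu> * slope f x0) * (s k - s (Suc k)))"
          by (intro sum_mono step)
        also have "\<dots> = \<epsilon> * (\<Sum>k<N. dist (x k) (x (Suc k))) + (\<mu> * slope f x0) * (s 0 - s N)"
          by (simp only: sum.distrib sum_distrib_left[symmetric] sum_lessThan_telescope')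
        also have "\<dots> \<le> \<epsilon> * (K * (2 * d)) + (\<mu> * slope f x0) * slope f x0"
          using lam s_nonneg \<epsilon> len by (intro add_mono mult_left_mono) (auto simp: s_def x0)
        finally show ?thesis by (simp add: \<phi>_def x0 power2_eq_square algebra_simps)
      qed
      \<comment> \<open>With \<open>\<mu>\<close> fixed, finite length forces the steps to 0, so
        this bound drives the values of \<open>f\<close> to the minimum.\<close>
      have gap: "f (x (Suc k)) - f p \<le> (dist (x k) (x (Suc k)) / \<mu>) * d" for k
      proof -
        let ?v = "(1 / \<mu>) *\<^sub>R (x k - x (Suc k))"
        have "inner ?v (p - x (Suc k)) \<le> f p - f (x (Suc k))"
          using sub[of k] unfolding subdiff_def by blast
        then have "f (x (Suc k)) - f p \<le> inner ?v (x (Suc k) - p)" by (simp add: inner_diff_right)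
        also have "\<dots> \<le> norm ?v * norm (x (Suc k) - p)" by (rule norm_cauchy_schwarz)
        also have "\<dots> = (dist (x k) (x (Suc k)) / \<mu>) * dist (x (Suc k)) p"
          using lam by (simp add: dist_norm)
        also have "\<dots> \<le> (dist (x k) (x (Suc k)) / \<mu>) * d"
          using lam fejer by (intro mult_left_mono) auto
        finally show ?thesis .
      qed
      have "summable (\<lambda>k. dist (x k) (x (Suc k)))"
        by (rule summableI_nonneg_bounded[where x = "K * (2 * d)"]) (use len in auto)
      then have "(\<lambda>k. dist (x k) (x (Suc k))) \<longlonglongrightarrow> 0" by (rule summable_LIMSEQ_zero)
      then have "(\<lambda>k. (dist (x k) (x (Suc k)) / \<mu>) * d) \<longlonglongrightarrow> 0 / \<mu> * d"
        by (intro tendsto_intros) (use lam in auto)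
      then have "(\<lambda>k. (dist (x k) (x (Suc k)) / \<mu>) * d) \<longlonglongrightarrow> 0" by simp
      then have "(\<lambda>k. f (x (Suc k)) - f p) \<longlonglongrightarrow> 0"
        by (rule tendsto_sandwich[OF _ _ tendsto_const, rotated 2])
          (use gap pmin in \<open>auto intro!: always_eventually\<close>)
      then have "(\<lambda>k. f (x (Suc k))) \<longlonglongrightarrow> f p" by (rule LIM_zero_cancel)
      then have f_lim: "(\<lambda>k. f (x k)) \<longlonglongrightarrow> f p" by (rule LIMSEQ_imp_Suc)
      \<comment> \<open>A subsequence suffices because \<open>\<phi>_bound\<close> holds for every
        \<open>N\<close>.\<close>
      have "\<forall>k. x k \<in> cball p d" using fejer by (simp add: dist_commute)
      then obtain l \<rho> where l: "strict_mono \<rho>" "(x \<circ> \<rho>) \<longlonglongrightarrow> l"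
        using compact_cball[of p d] unfolding compact_def by metis
      have "(\<lambda>k. f (x (\<rho> k))) \<longlonglongrightarrow> f l"
        using continuous_on_tendsto_compose[OF f(2) l(2)] by (simp add: o_def)
      moreover have "(\<lambda>k. f (x (\<rho> k))) \<longlonglongrightarrow> f p"
        using LIMSEQ_subseq_LIMSEQ[OF f_lim l(1)] by (simp add: o_def)
      ultimately have "f l = f p" by (rule LIMSEQ_unique)
      then have lC: "l \<in> argmin_set f" using pmin by (simp add: argmin_set_def)
      have "(\<lambda>k. \<phi> (\<rho> k)) \<longlonglongrightarrow> g l - f l"
        unfolding \<phi>_def
        using tendsto_diff[OF continuous_on_tendsto_compose[OF g(2) l(2)] continuous_on_tendsto_compose[OF f(2) l(2)]]
        by (simp add: o_def)
      then have "(\<lambda>k. 2 * K * \<epsilon> * d + \<mu> * (slope f x0)\<^sup>2 + \<phi> (\<rho> k))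
          \<longlonglongrightarrow> 2 * K * \<epsilon> * d + \<mu> * (slope f x0)\<^sup>2 + (g l - f l)"
        by (intro tendsto_intros)
      then have "g x0 - f x0 \<le> 2 * K * \<epsilon> * d + \<mu> * (slope f x0)\<^sup>2 + (g l - f l)"
        by (rule tendsto_lowerbound) (auto simp: \<phi>_bound)
      then show ?thesis using M[OF lC] by linarith
    qed
    \<comment> \<open>The limit point varied with \<open>\<mu>\<close>, but \<open>M\<close> bounds
      \<open>g - f\<close> at every minimiser, so \<open>\<mu>\<close> can tend to 0.\<close>
    have "((\<lambda>\<mu>. 2 * K * \<epsilon> * d + M + \<mu> * (slope f x0)\<^sup>2)
        \<longlongrightarrow> 2 * K * \<epsilon> * d + M + 0 * (slope f x0)\<^sup>2) (at_right 0)"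
      by (intro tendsto_intros)
    then have "g x0 - f x0 \<le> 2 * K * \<epsilon> * d + M + 0 * (slope f x0)\<^sup>2"
      by (rule tendsto_lowerbound)
        (auto simp: eventually_at_right_field intro!: bound exI[of _ 1])
    then show ?thesis by (simp add: d_def)
  qed
  then show ?thesis using K0 by (intro exI[of _ "2 * K"]) auto
qed

section \<open>Extended-valued suprema and the theorem\<close>

text \<open>The set must be nonempty because an empty supremum in \<open>ereal\<close> is
  \<open>-\<infinity>\<close>.\<close>

lemma pos_sup_nonneg: "U \<noteq> {} \<Longrightarrow> 0 \<le> pos_sup w U"
  unfolding pos_sup_def by (auto intro: SUP_upper2 simp flip: zero_ereal_def)

lemma le_pos_sup: "x \<in> U \<Longrightarrow> ereal (w x) \<le> pos_sup w U"
  unfolding pos_sup_def by (rule SUP_upper2) auto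

theorem theorem1:
  shows "\<exists>K>0. \<forall>(f::real^'n \<Rightarrow> real) (g::real^'n \<Rightarrow> real) (r::real).
    convex_on UNIV f \<and> convex_on UNIV g \<and> continuous_on UNIV f \<and> continuous_on UNIV g
    \<and> argmin_set f \<noteq> {} \<and> r > 0 \<longrightarrow>
    (\<forall>x. infdist x (argmin_set f) \<le> r \<longrightarrow>
       ereal (g x - f x) \<le>
         ereal K * pos_sup (\<lambda>y. slope g y - slope f y) {y. infdist y (argmin_set f) \<le> r}
                 * ereal (infdist x (argmin_set f))
         + pos_sup (\<lambda>y. g y - f y) (argmin_set f))"
proof -
  obtain K where K0: "K > 0" and K: "\<And>(f::real^'n \<Rightarrow> real) (g::real^'n \<Rightarrow> real) x0 \<epsilon> M.
    convex_on UNIV f \<and> convex_on UNIV g \<and> continuous_on UNIV f \<and> continuous_on UNIV g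
    \<and> argmin_set f \<noteq> {} \<and> 0 \<le> \<epsilon>
    \<and> (\<forall>y. infdist y (argmin_set f) \<le> infdist x0 (argmin_set f) \<longrightarrow> slope g y \<le> slope f y + \<epsilon>)
    \<and> (\<forall>y\<in>argmin_set f. g y - f y \<le> M) \<Longrightarrow>
    g x0 - f x0 \<le> K * \<epsilon> * infdist x0 (argmin_set f) + M"
    using slope_comparison[where 'a="real^'n"] by metis
  show ?thesis
  proof (intro exI[of _ K] conjI K0 allI impI; elim conjE)
    fix f g :: "real^'n \<Rightarrow> real" and r :: real and x
    assume f: "convex_on UNIV f" "continuous_on UNIV f" and g: "convex_on UNIV g" "continuous_on UNIV g"
      and ne: "argmin_set f \<noteq> {}" and xr: "infdist x (argmin_set f) \<le> r"
    let ?C = "argmin_set f"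
    let ?U = "{y. infdist y ?C \<le> r}"
    let ?S = "pos_sup (\<lambda>y. slope g y - slope f y) ?U"
    let ?G = "pos_sup (\<lambda>y. g y - f y) ?C"
    have S0: "0 \<le> ?S" using xr by (intro pos_sup_nonneg) auto
    have G0: "0 \<le> ?G" using ne by (rule pos_sup_nonneg)
    show "ereal (g x - f x) \<le> ereal K * ?S * ereal (infdist x ?C) + ?G"
    \<comment> \<open>In \<open>ereal\<close>, \<open>\<infinity> * 0 = 0\<close>, so an infinite
      \<open>?S\<close> does not help at distance 0; there \<open>x\<close> is itself a minimiser
      and \<open>?G\<close> suffices.\<close>
    proof (cases "infdist x ?C = 0")
      case True
      then have "x \<in> ?C" using in_closed_iff_infdist_zero[OF closed_argmin_set[OF f(2)] ne] by blast
      then show ?thesis using True le_pos_sup[of x ?C "\<lambda>y. g y - f y"] by (simp flip: zero_ereal_def)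
    next
      case False
      then have d: "infdist x ?C > 0" using infdist_nonneg[of x ?C] by linarith
      show ?thesis
      proof (cases "?S = \<infinity> \<or> ?G = \<infinity>")
        case True
        then have "ereal K * ?S * ereal (infdist x ?C) + ?G = \<infinity>"
          using d K0 S0 G0 by (cases ?S; cases ?G) auto
        then show ?thesis by (simp only: ereal_less_eq)
      next
        case False
        then obtain e m where e: "?S = ereal e" and m: "?G = ereal m"
          using S0 G0 by (cases ?S; cases ?G) auto
        \<comment> \<open>Since \<open>x\<close> lies in \<open>?U\<close>, so does every point no
          farther from \<open>?C\<close> than \<open>x\<close>.\<close>
        have "slope g y \<le> slope f y + e" if "infdist y ?C \<le> infdist x ?C" for y
          using le_pos_sup[of y ?U "\<lambda>y. slope g y - slope f y"] that xr by (simp add: e)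
        moreover have "g y - f y \<le> m" if "y \<in> ?C" for y
          using le_pos_sup[OF that, of "\<lambda>y. g y - f y"] by (simp add: m)
        ultimately have "g x - f x \<le> K * e * infdist x ?C + m"
          using K[of f g e x m] f g ne S0 by (simp add: e)
        then show ?thesis by (simp add: e m)
      qed
    qed
  qed
qed

end
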